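(* The logic $\mathsf L(\mathfrak G_2)\cap\mathsf L(\mathfrak F_3)$ has nullary unification.
   Context: A frame is a finite poset with a least element; $\mathsf L(\mathfrak F)$ is the set of intuitionistic formulas valid in all Kripke models over $\mathfrak F$. $\mathfrak G_2$: elements $r,a,b,c,d$ with $r<a$, $r<b$, $b<c$, $b<d$ (and transitivity), $a,c,d$ maximal, no other relations. $\mathfrak F_3$ is the 3-fork: a root with three pairwise incomparable maximal elements above it. Unification in a logic $\mathsf L$ is nullary if some $\mathsf L$-unifiable formula has no minimal (w.r.t. inclusion) complete set of unifiers, where a set $\Sigma$ of unifiers of $A$ is complete if every unifier $\mu$ of $A$ satisfies $\alpha\circ\varepsilon=_{\mathsf L}\mu$ for some $\varepsilon\in\Sigma$ and substitution $\alpha$. *)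

theory Defs
  imports Main
begin

datatype form =
    Var nat
  | Bot
  | And form form
  | Or form form
  | Imp form form

definition Iff :: "form \<Rightarrow> form \<Rightarrow> form" where
  "Iff A B = And (Imp A B) (Imp B A)"

primrec vars :: "form \<Rightarrow> nat set" where
  "vars (Var x) = {x}"
| "vars Bot = {}"
| "vars (And A B) = vars A \<union> vars B"
| "vars (Or A B) = vars A \<union> vars B"
| "vars (Imp A B) = vars A \<union> vars B"

type_synonym subst = "nat \<Rightarrow> form"

primrec subst_form :: "subst \<Rightarrow> form \<Rightarrow> form" where
  "subst_form s (Var x) = s x"
| "subst_form s Bot = Bot"
| "subst_form s (And A B) = And (subst_form s A) (subst_form s B)"
| "subst_form s (Or A B) = Or (subst_form s A) (subst_form s B)"
| "subst_form s (Imp A B) = Imp (subst_form s A) (subst_form s B)"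

definition subst_comp :: "subst \<Rightarrow> subst \<Rightarrow> subst" where
  "subst_comp \<alpha> \<epsilon> = (\<lambda>x. subst_form \<alpha> (\<epsilon> x))"

text \<open>A pair of a carrier and its (reflexive) order.\<close>

type_synonym 'w frame = "'w set \<times> 'w rel"

definition is_frame :: "'w frame \<Rightarrow> bool" where
  "is_frame F \<longleftrightarrow> finite (fst F) \<and> partial_order_on (fst F) (snd F)
     \<and> (\<exists>r\<in>fst F. \<forall>w\<in>fst F. (r, w) \<in> snd F)"

definition valuation :: "'w frame \<Rightarrow> (nat \<Rightarrow> 'w set) \<Rightarrow> bool" where
  "valuation F V \<longleftrightarrow>
     (\<forall>x. V x \<subseteq> fst F \<and> (\<forall>w v. w \<in> V x \<longrightarrow> (w, v) \<in> snd F \<longrightarrow> v \<in> V x))"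

primrec forces :: "'w frame \<Rightarrow> (nat \<Rightarrow> 'w set) \<Rightarrow> 'w \<Rightarrow> form \<Rightarrow> bool" where
  "forces F V w (Var x) \<longleftrightarrow> w \<in> V x"
| "forces F V w Bot \<longleftrightarrow> False"
| "forces F V w (And A B) \<longleftrightarrow> forces F V w A \<and> forces F V w B"
| "forces F V w (Or A B) \<longleftrightarrow> forces F V w A \<or> forces F V w B"
| "forces F V w (Imp A B) \<longleftrightarrow>
     (\<forall>v\<in>fst F. (w, v) \<in> snd F \<longrightarrow> forces F V v A \<longrightarrow> forces F V v B)"

definition logic_of :: "'w frame \<Rightarrow> form set" where
  "logic_of F = {A. \<forall>V. valuation F V \<longrightarrow> (\<forall>w\<in>fst F. forces F V w A)}"

text \<open>
  A unifier of \<open>A\<close> is a substitution for the variables of \<open>A\<close>. Substitutions are rendered as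
  total functions, so equality modulo the logic is taken on a given set \<open>X\<close> of variables, which
  for unifiers of \<open>A\<close> is \<open>vars A\<close>; their values elsewhere are irrelevant.
\<close>

definition subst_eq :: "form set \<Rightarrow> nat set \<Rightarrow> subst \<Rightarrow> subst \<Rightarrow> bool" where
  "subst_eq L X s t \<longleftrightarrow> (\<forall>x\<in>X. Iff (s x) (t x) \<in> L)"

definition unifier :: "form set \<Rightarrow> form \<Rightarrow> subst \<Rightarrow> bool" where
  "unifier L A s \<longleftrightarrow> subst_form s A \<in> L"

definition unifiable :: "form set \<Rightarrow> form \<Rightarrow> bool" where
  "unifiable L A \<longleftrightarrow> (\<exists>s. unifier L A s)"

definition complete_unifiers :: "form set \<Rightarrow> form \<Rightarrow> subst set \<Rightarrow> bool" where
  "complete_unifiers L A S \<longleftrightarrow>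
     (\<forall>\<epsilon>\<in>S. unifier L A \<epsilon>) \<and>
     (\<forall>\<mu>. unifier L A \<mu> \<longrightarrow> (\<exists>\<epsilon>\<in>S. \<exists>\<alpha>. subst_eq L (vars A) (subst_comp \<alpha> \<epsilon>) \<mu>))"

definition minimal_complete_unifiers :: "form set \<Rightarrow> form \<Rightarrow> subst set \<Rightarrow> bool" where
  "minimal_complete_unifiers L A S \<longleftrightarrow>
     complete_unifiers L A S \<and> (\<forall>T. T \<subset> S \<longrightarrow> \<not> complete_unifiers L A T)"

definition nullary_unification :: "form set \<Rightarrow> bool" where
  "nullary_unification L \<longleftrightarrow>
     (\<exists>A. unifiable L A \<and> \<not> (\<exists>S. minimal_complete_unifiers L A S))"

datatype g2 = Gr | Ga | Gb | Gc | Gd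

definition G2 :: "g2 frame" where
  "G2 = (UNIV, {(Gr, Ga), (Gr, Gb), (Gb, Gc), (Gb, Gd)}\<^sup>*)"

datatype f3 = Root | Leaf1 | Leaf2 | Leaf3

definition F3 :: "f3 frame" where
  "F3 = (UNIV, {(Root, Leaf1), (Root, Leaf2), (Root, Leaf3)}\<^sup>*)"

lemma G2_order:
  "snd G2 = Id \<union> {(Gr, Ga), (Gr, Gb), (Gr, Gc), (Gr, Gd), (Gb, Gc), (Gb, Gd)}"
  (is "_ = ?R")
proof
  let ?E = "{(Gr, Ga), (Gr, Gb), (Gb, Gc), (Gb, Gd)}"
  have "(x, y) \<in> ?R" if "(x, y) \<in> ?E\<^sup>*" for x y
    using that by (induction rule: rtrancl_induct) auto
  then show "snd G2 \<subseteq> ?R" by (auto simp: G2_def)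
  have "(Gr, Gc) \<in> ?E\<^sup>*" "(Gr, Gd) \<in> ?E\<^sup>*"
    by (rule rtrancl_trans[of _ Gb]; blast)+
  then show "?R \<subseteq> snd G2" by (auto simp: G2_def)
qed

lemma F3_order: "snd F3 = Id \<union> {(Root, Leaf1), (Root, Leaf2), (Root, Leaf3)}"
  (is "_ = ?R")
proof
  have "(x, y) \<in> ?R" if "(x, y) \<in> {(Root, Leaf1), (Root, Leaf2), (Root, Leaf3)}\<^sup>*" for x y
    using that by (induction rule: rtrancl_induct) auto
  then show "snd F3 \<subseteq> ?R" by (auto simp: F3_def)
  show "?R \<subseteq> snd F3" by (auto simp: F3_def)
qed

lemma is_frame_G2: "is_frame G2"
proof -
  have "(UNIV :: g2 set) = {Gr, Ga, Gb, Gc, Gd}" using g2.exhaust by blast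
  then have "finite (UNIV :: g2 set)" by (metis finite.emptyI finite_insert)
  moreover have "(Gr, w) \<in> snd G2" for w by (cases w) (auto simp: G2_order)
  moreover have "partial_order_on UNIV (snd G2)"
    unfolding partial_order_on_def preorder_on_def G2_order
    by (auto simp: refl_on_def trans_def antisym_def)
  ultimately show ?thesis unfolding is_frame_def by (auto simp: G2_def)
qed

lemma is_frame_F3: "is_frame F3"
proof -
  have "(UNIV :: f3 set) = {Root, Leaf1, Leaf2, Leaf3}" using f3.exhaust by blast
  then have "finite (UNIV :: f3 set)" by (metis finite.emptyI finite_insert)
  moreover have "(Root, w) \<in> snd F3" for w by (cases w) (auto simp: F3_order)
  moreover have "partial_order_on UNIV (snd F3)"
    unfolding partial_order_on_def preorder_on_def F3_order
    by (auto simp: refl_on_def trans_def antisym_def)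
  ultimately show ?thesis unfolding is_frame_def by (auto simp: F3_def)
qed

end

theory Submission
  imports Defs
begin

text \<open>
  Take \<open>A = (y \<longrightarrow> \<not>u \<or> \<not>\<not>u) \<or> \<not>\<not>y\<close>. A unifier \<open>(U, Y)\<close> of \<open>A\<close> for which all of
  \<open>Y \<and> U\<close>, \<open>Y \<and> \<not>U\<close>, \<open>\<not>Y\<close> are classically satisfiable is never maximal. Let \<open>q\<close> be a fresh
  variable, and make every maximal point refuting \<open>q\<close> satisfy \<open>Y' \<and> \<not>U'\<close>; a point seeing maximal
  points of both kinds may force \<open>Y'\<close> only if two of the maximal points above it that refute \<open>q\<close>
  differ on an old variable. A failure of \<open>A\<close> under \<open>(U', Y')\<close> at a point seeing a maximal point
  that refutes \<open>q\<close> would need four maximal points, but both frames have only three.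

  Putting \<open>q = \<top>\<close> returns \<open>(U, Y)\<close>. Suppose conversely that \<open>\<alpha>\<close> carries \<open>(U, Y)\<close> to \<open>(U', Y')\<close>.
  Then \<open>\<alpha>\<close> maps the classical assignments of the old variables (taken with \<open>q\<close> false) to
  assignments satisfying \<open>\<not>U\<close>, hence not surjectively, so it identifies two of them.
  The 3-fork over these two and an assignment with \<open>Y \<and> U\<close> forces \<open>Y'\<close> at its root; its image
  under \<open>\<alpha>\<close> is a 2-fork forcing \<open>Y\<close>, and placing it in \<open>\<GG>\<^sub>2\<close> beside a maximal point with \<open>\<not>Y\<close>
  refutes \<open>A\<close>.
\<close>

subsection \<open>Kripke semantics\<close>

definition Neg :: "form \<Rightarrow> form" where
  "Neg A = Imp A Bot"

definition Top :: form where
  "Top = Neg Bot"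

definition Conj :: "form list \<Rightarrow> form" where
  "Conj As = foldr And As Top"

lemma forces_Neg:
  "forces F V w (Neg A) \<longleftrightarrow> (\<forall>v\<in>fst F. (w, v) \<in> snd F \<longrightarrow> \<not> forces F V v A)"
  by (simp add: Neg_def)

lemma forces_Top [simp]: "forces F V w Top"
  by (simp add: Top_def forces_Neg)

lemma forces_Conj [simp]: "forces F V w (Conj As) \<longleftrightarrow> (\<forall>A\<in>set As. forces F V w A)"
  by (induction As) (simp_all add: Conj_def)

lemma forces_Iff:
  "forces F V w (Iff A B) \<longleftrightarrow>
     (\<forall>v\<in>fst F. (w, v) \<in> snd F \<longrightarrow> (forces F V v A \<longleftrightarrow> forces F V v B))"
  by (auto simp: Iff_def)

lemma subst_form_Neg [simp]: "subst_form s (Neg A) = Neg (subst_form s A)"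
  by (simp add: Neg_def)

lemma finite_vars: "finite (vars A)"
  by (induction A) simp_all

lemma subst_form_cong: "(\<And>x. x \<in> vars A \<Longrightarrow> s x = t x) \<Longrightarrow> subst_form s A = subst_form t A"
  by (induction A) simp_all

lemma subst_form_Var: "subst_form Var A = A"
  by (induction A) simp_all

lemma subst_form_comp: "subst_form (subst_comp \<beta> \<alpha>) A = subst_form \<beta> (subst_form \<alpha> A)"
  by (induction A) (simp_all add: subst_comp_def)

definition pull_val :: "'w frame \<Rightarrow> (nat \<Rightarrow> 'w set) \<Rightarrow> subst \<Rightarrow> nat \<Rightarrow> 'w set" where
  "pull_val F V s x = {w \<in> fst F. forces F V w (s x)}"

lemma forces_subst:
  "w \<in> fst F \<Longrightarrow> forces F V w (subst_form s A) \<longleftrightarrow> forces F (pull_val F V s) w A"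
  by (induction A arbitrary: w) (simp_all add: pull_val_def)

text \<open>Applied to collapse a 3-fork, two of whose leaves carry the same assignment, onto the
  part of \<open>G2\<close> above \<open>Gb\<close>.\<close>

lemma forces_p_morphism:
  assumes "\<And>w. w \<in> fst F \<Longrightarrow> h w \<in> fst G"
    and "\<And>w v. w \<in> fst F \<Longrightarrow> v \<in> fst F \<Longrightarrow> (w, v) \<in> snd F \<Longrightarrow> (h w, h v) \<in> snd G"
    and "\<And>w v. w \<in> fst F \<Longrightarrow> v \<in> fst G \<Longrightarrow> (h w, v) \<in> snd G \<Longrightarrow> \<exists>v'\<in>fst F. (w, v') \<in> snd F \<and> h v' = v"
    and "\<And>w x. w \<in> fst F \<Longrightarrow> x \<in> vars A \<Longrightarrow> w \<in> V x \<longleftrightarrow> h w \<in> W x"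
    and "w \<in> fst F"
  shows "forces F V w A \<longleftrightarrow> forces G W (h w) A"
  using assms(4,5)
proof (induction A arbitrary: w)
  case (Imp A B)
  have *: "forces F V v A \<longleftrightarrow> forces G W (h v) A" "forces F V v B \<longleftrightarrow> forces G W (h v) B"
    if "v \<in> fst F" for v
    using Imp that by auto
  show ?case
    using * assms(1-3) Imp.prems(2) by simp metis
qed auto

primrec classical :: "nat set \<Rightarrow> form \<Rightarrow> bool" where
  "classical T (Var x) \<longleftrightarrow> x \<in> T"
| "classical T Bot \<longleftrightarrow> False"
| "classical T (And A B) \<longleftrightarrow> classical T A \<and> classical T B"
| "classical T (Or A B) \<longleftrightarrow> classical T A \<or> classical T B"
| "classical T (Imp A B) \<longleftrightarrow> (classical T A \<longrightarrow> classical T B)"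

lemma classical_Neg [simp]: "classical T (Neg A) \<longleftrightarrow> \<not> classical T A"
  by (simp add: Neg_def)

lemma classical_cong: "vars A \<subseteq> X \<Longrightarrow> T \<inter> X = T' \<inter> X \<Longrightarrow> classical T A \<longleftrightarrow> classical T' A"
  by (induction A) auto

lemma classical_subst: "classical T (subst_form s A) \<longleftrightarrow> classical {x. classical T (s x)} A"
  by (induction A) simp_all

text \<open>The only features of the two frames that matter for the positive part of the argument.\<close>

locale three_leaves =
  fixes F :: "'w frame" and M :: "'w set"
  assumes frame: "is_frame F"
    and leaf: "m \<in> M \<Longrightarrow> m \<in> fst F"
    and leaf_maximal: "m \<in> M \<Longrightarrow> (m, v) \<in> snd F \<Longrightarrow> v = m"
    and below_leaf: "w \<in> fst F \<Longrightarrow> \<exists>m\<in>M. (w, m) \<in> snd F"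
    and finite_leaves: "finite M"
    and card_leaves: "card M \<le> 3"
begin

lemma order_refl: "w \<in> fst F \<Longrightarrow> (w, w) \<in> snd F"
  using frame by (auto simp: is_frame_def partial_order_on_def preorder_on_def refl_on_def)

lemma order_trans: "(w, v) \<in> snd F \<Longrightarrow> (v, u) \<in> snd F \<Longrightarrow> (w, u) \<in> snd F"
  using frame unfolding is_frame_def partial_order_on_def preorder_on_def
  by (blast dest: transD)

lemma forces_mono:
  "valuation F V \<Longrightarrow> (w, v) \<in> snd F \<Longrightarrow> forces F V w A \<Longrightarrow> forces F V v A"
  by (induction A) (auto simp: valuation_def dest: order_trans)

lemma valuation_pull_val: "valuation F V \<Longrightarrow> valuation F (pull_val F V s)"
  using frame forces_mono
  by (auto simp: valuation_def pull_val_def is_frame_def partial_order_on_def preorder_on_def)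

lemma leaf_forces: "m \<in> M \<Longrightarrow> forces F V m A \<longleftrightarrow> classical {x. m \<in> V x} A"
proof (induction A)
  case (Imp A B)
  then show ?case using leaf_maximal leaf order_refl by simp blast
qed simp_all

lemma forces_Neg_leaf:
  assumes "valuation F V" "w \<in> fst F"
  shows "forces F V w (Neg A) \<longleftrightarrow>
    (\<forall>m\<in>M. (w, m) \<in> snd F \<longrightarrow> \<not> classical {x. m \<in> V x} A)"
proof
  assume "forces F V w (Neg A)"
  then show "\<forall>m\<in>M. (w, m) \<in> snd F \<longrightarrow> \<not> classical {x. m \<in> V x} A"
    using leaf leaf_forces by (auto simp: forces_Neg)
next
  assume *: "\<forall>m\<in>M. (w, m) \<in> snd F \<longrightarrow> \<not> classical {x. m \<in> V x} A"
  show "forces F V w (Neg A)"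
    unfolding forces_Neg
  proof (intro ballI impI notI)
    fix v assume "v \<in> fst F" "(w, v) \<in> snd F" "forces F V v A"
    moreover from this obtain m where "m \<in> M" "(v, m) \<in> snd F" using below_leaf by blast
    ultimately show False using * assms(1) forces_mono leaf_forces order_trans by metis
  qed
qed

lemma forces_NegNeg_leaf:
  assumes "valuation F V" "w \<in> fst F"
  shows "forces F V w (Neg (Neg A)) \<longleftrightarrow>
    (\<forall>m\<in>M. (w, m) \<in> snd F \<longrightarrow> classical {x. m \<in> V x} A)"
  using forces_Neg_leaf[OF assms, of "Neg A"] by simp

lemma logic_of_subst: "A \<in> logic_of F \<Longrightarrow> subst_form s A \<in> logic_of F"
  by (auto simp: logic_of_def forces_subst valuation_pull_val)

lemma logic_of_Iff_trans:
  "Iff A B \<in> logic_of F \<Longrightarrow> Iff B C \<in> logic_of F \<Longrightarrow> Iff A C \<in> logic_of F"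
  by (simp add: logic_of_def forces_Iff)

text \<open>A constant valuation is upward closed, and leaves evaluate formulas classically.\<close>

lemma logic_of_classical:
  assumes "A \<in> logic_of F"
  shows "classical T A"
proof -
  obtain m where m: "m \<in> M" using frame below_leaf by (auto simp: is_frame_def)
  let ?V = "\<lambda>x. {w \<in> fst F. x \<in> T}"
  have "valuation F ?V"
    using frame by (auto simp: valuation_def is_frame_def partial_order_on_def preorder_on_def)
  then have "forces F ?V m A" using assms m leaf by (auto simp: logic_of_def)
  then show ?thesis using m leaf by (simp add: leaf_forces)
qed

end

lemma fst_G2 [simp]: "fst G2 = UNIV"
  by (simp add: G2_def)

lemma fst_F3 [simp]: "fst F3 = UNIV"
  by (simp add: F3_def)

interpretation G2: three_leaves G2 "{Ga, Gc, Gd}"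
proof
  show "\<exists>m\<in>{Ga, Gc, Gd}. (w, m) \<in> snd G2" for w by (cases w) (auto simp: G2_order)
qed (auto simp: is_frame_G2 G2_order)

interpretation F3: three_leaves F3 "{Leaf1, Leaf2, Leaf3}"
proof
  show "\<exists>m\<in>{Leaf1, Leaf2, Leaf3}. (w, m) \<in> snd F3" for w by (cases w) (auto simp: F3_order)
qed (auto simp: is_frame_F3 F3_order)

subsection \<open>The formula and its unifiers\<close>

definition decided :: "form \<Rightarrow> form" where
  "decided A = Or (Neg A) (Neg (Neg A))"

definition fork_form :: "form \<Rightarrow> form \<Rightarrow> form" where
  "fork_form U Y = Or (Imp Y (decided U)) (Neg (Neg Y))"

text \<open>The double negations speak about leaves only: those above a point that refute
  \<open>Q\<close> all satisfy \<open>A\<close>, or all refute it.\<close>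

definition agree :: "form list \<Rightarrow> form \<Rightarrow> form" where
  "agree As Q = Conj (map (\<lambda>A. Or (Neg (Neg (Or Q A))) (Neg (Neg (Or Q (Neg A))))) As)"

definition ext_U :: "form \<Rightarrow> form \<Rightarrow> form" where
  "ext_U Q U = And U (Neg (Neg Q))"

text \<open>The new \<open>Y\<close>: it holds at leaves refuting \<open>Q\<close>, reduces to
  \<open>Y\<close> where all leaves above satisfy \<open>Q\<close>, and at a point seeing both kinds
  requires two leaves that refute \<open>Q\<close> and differ on some member of
  \<open>As\<close>.\<close>

definition ext_Y :: "form list \<Rightarrow> form \<Rightarrow> form \<Rightarrow> form" where
  "ext_Y As Q Y = And (Imp (Neg (Neg Q)) Y) (Imp (agree As Q) (decided Q))"

lemma subst_fork_form [simp]: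
  "subst_form s (fork_form U Y) = fork_form (subst_form s U) (subst_form s Y)"
  by (simp add: fork_form_def decided_def)

lemma classical_decided [simp]: "classical T (decided A)"
  by (simp add: decided_def)

lemma classical_ext_U [simp]: "classical T (ext_U Q U) \<longleftrightarrow> classical T U \<and> classical T Q"
  by (simp add: ext_U_def)

lemma classical_ext_Y [simp]: "classical T (ext_Y As Q Y) \<longleftrightarrow> (classical T Q \<longrightarrow> classical T Y)"
  by (simp add: ext_Y_def)

section \<open>Refutations in terms of leaves, and unifiers obtained by extension\<close>

context three_leaves
begin

lemma forces_decided:
  assumes "valuation F V" "w \<in> fst F"
  shows "forces F V w (decided A) \<longleftrightarrow>
    \<not> (\<exists>c\<in>M. \<exists>d\<in>M. (w, c) \<in> snd F \<and> (w, d) \<in> snd F \<and>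
      \<not> classical {x. c \<in> V x} A \<and> classical {x. d \<in> V x} A)"
  using forces_Neg_leaf[OF assms] forces_NegNeg_leaf[OF assms]
  by (simp add: decided_def) blast

text \<open>A refutation has the shape of \<open>G2\<close>: the points \<open>w\<close>,
  \<open>v\<close>, \<open>a\<close>, \<open>c\<close>, \<open>d\<close> play \<open>Gr\<close>,
  \<open>Gb\<close>, \<open>Ga\<close>, \<open>Gc\<close>, \<open>Gd\<close>.\<close>

lemma forces_fork_form:
  assumes "valuation F V" "w \<in> fst F"
  shows "forces F V w (fork_form U Y) \<longleftrightarrow>
    \<not> (\<exists>v\<in>fst F. \<exists>a\<in>M. \<exists>c\<in>M. \<exists>d\<in>M. (w, v) \<in> snd F \<and> (w, a) \<in> snd F \<and>
      (v, c) \<in> snd F \<and> (v, d) \<in> snd F \<and> forces F V v Y \<and> \<not> classical {x. a \<in> V x} Y \<and>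
      \<not> classical {x. c \<in> V x} U \<and> classical {x. d \<in> V x} U)"
  using forces_NegNeg_leaf[OF assms] forces_decided[OF assms(1)]
  by (simp add: fork_form_def) blast

lemma forces_agree:
  assumes "valuation F V" "w \<in> fst F"
  shows "forces F V w (agree As Q) \<longleftrightarrow>
    (\<forall>A\<in>set As. \<exists>b. \<forall>m\<in>M. (w, m) \<in> snd F \<longrightarrow> \<not> classical {x. m \<in> V x} Q \<longrightarrow>
      classical {x. m \<in> V x} A = b)"
  using forces_NegNeg_leaf[OF assms]
  by (simp add: agree_def ex_bool_eq) blast

text \<open>If \<open>n\<close> were the only leaf refuting \<open>Q\<close>, agreement would hold
  trivially at \<open>v\<close> and force \<open>Q\<close> to be decided there, against
  \<open>d\<close> and \<open>n\<close>.\<close>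

lemma decided_or_two_leaves:
  assumes V: "valuation F V" and v: "v \<in> fst F"
    and imp: "forces F V v (Imp (agree As Q) (decided Q))"
    and d: "d \<in> M" "(v, d) \<in> snd F" "classical {x. d \<in> V x} Q"
    and n: "n \<in> M" "(v, n) \<in> snd F" "\<not> classical {x. n \<in> V x} Q"
  shows "\<exists>n'\<in>M. n' \<noteq> n \<and> \<not> classical {x. n' \<in> V x} Q"
proof (rule ccontr)
  assume "\<not> ?thesis"
  then have "forces F V v (agree As Q)"
    by (auto simp: forces_agree[OF V v] intro!: exI[of _ "classical {x. n \<in> V x} _"])
  then have "forces F V v (decided Q)"
    using imp v order_refl by auto
  then show False using d n by (auto simp: forces_decided[OF V v])
qed

text \<open>In a refutation, \<open>a\<close> satisfies \<open>Q\<close> because it refutes the new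
  \<open>Y\<close>, and \<open>d\<close> because it satisfies the new \<open>U\<close>. Counting
  leaves then shows that every leaf above \<open>v\<close> satisfies \<open>Q\<close>, where the new
  pair behaves like the old one.\<close>

lemma fork_form_ext:
  assumes "fork_form U Y \<in> logic_of F"
  shows "fork_form (ext_U Q U) (ext_Y As Q Y) \<in> logic_of F"
proof -
  have "forces F V w (fork_form (ext_U Q U) (ext_Y As Q Y))"
    if V: "valuation F V" and w: "w \<in> fst F" for V w
  proof (rule ccontr)
    assume "\<not> ?thesis"
    then obtain v a c d where v: "v \<in> fst F" "(w, v) \<in> snd F" "forces F V v (ext_Y As Q Y)"
      and leaves: "a \<in> M" "c \<in> M" "d \<in> M" "(w, a) \<in> snd F" "(v, c) \<in> snd F" "(v, d) \<in> snd F"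
      and a: "classical {x. a \<in> V x} Q" "\<not> classical {x. a \<in> V x} Y"
      and c: "\<not> (classical {x. c \<in> V x} U \<and> classical {x. c \<in> V x} Q)"
      and d: "classical {x. d \<in> V x} U" "classical {x. d \<in> V x} Q"
      unfolding forces_fork_form[OF V w] by auto
    have dY: "classical {x. d \<in> V x} Y"
      using forces_mono[OF V leaves(6) v(3)] leaf_forces[OF leaves(3)] d by simp
    have allQ: "classical {x. n \<in> V x} Q" if n: "n \<in> M" "(v, n) \<in> snd F" for n
    proof (rule ccontr)
      assume nQ: "\<not> ?thesis"
      then obtain n' where n': "n' \<in> M" "n' \<noteq> n" "\<not> classical {x. n' \<in> V x} Q"
        using decided_or_two_leaves[OF V v(1) _ leaves(3,6) d(2) n, of As] v(3)
        by (auto simp: ext_Y_def)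
      \<comment> \<open>\<open>a\<close> and \<open>d\<close> satisfy \<open>Q\<close> and differ on
        \<open>Y\<close>; \<open>n\<close> and \<open>n'\<close> refute \<open>Q\<close>.\<close>
      have "card {a, d, n, n'} = 4"
        using n' nQ a d dY by (auto simp: card_insert_if)
      moreover have "card {a, d, n, n'} \<le> card M"
        using n n' leaves finite_leaves by (intro card_mono) auto
      ultimately show False using card_leaves by simp
    qed
    then have "forces F V v Y"
      using v order_refl by (auto simp: ext_Y_def forces_NegNeg_leaf[OF V])
    moreover have "forces F V w (fork_form U Y)"
      using assms V w by (auto simp: logic_of_def)
    ultimately show False
      using v leaves a c d allQ unfolding forces_fork_form[OF V w] by blast
  qed
  then show ?thesis by (simp add: logic_of_def)
qed

lemma forces_NegNeg_Top: "w \<in> fst F \<Longrightarrow> forces F V w (Neg (Neg Top))"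
  by (auto simp: forces_Neg intro: order_refl)

lemma ext_U_Top: "Iff (ext_U Top U) U \<in> logic_of F"
  by (simp add: logic_of_def forces_Iff ext_U_def forces_NegNeg_Top)

lemma ext_Y_Top: "Iff (ext_Y As Top Y) Y \<in> logic_of F"
  using forces_mono order_refl
  by (auto simp: logic_of_def forces_Iff ext_Y_def decided_def forces_NegNeg_Top)

text \<open>The added conjunct makes the first disjunct valid and is a classical tautology, so it
  leaves \<open>Y\<close> classically unchanged.\<close>

lemma fork_form_unifiable: "fork_form U (And Y (decided U)) \<in> logic_of F"
  using forces_mono order_refl by (auto simp: logic_of_def fork_form_def)

end

section \<open>The extended pair is not an instance of the old one\<close>

lemma ext_not_less_general:
  assumes unif: "fork_form U Y \<in> logic_of G2"
    and X: "finite X" "vars U \<subseteq> X" "vars Y \<subseteq> X" "set xs = X" "q \<notin> X"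
    and D: "classical D U" "classical D Y"
    and E: "\<not> classical E Y"
    and eqU: "Iff (subst_form \<alpha> U) (ext_U (Var q) U) \<in> logic_of F3"
    and eqY: "Iff (subst_form \<alpha> Y) (ext_Y (map Var xs) (Var q) Y) \<in> logic_of F3"
  shows False
proof -
  \<comment> \<open>The action of \<open>\<alpha>\<close> on classical assignments, cut down to a
    self-map of the finite set \<open>Pow X\<close>, whose members all make \<open>q\<close>
    false.\<close>
  define img where "img T = {x \<in> X. classical T (\<alpha> x)}" for T
  have img: "classical (img T) A \<longleftrightarrow> classical T (subst_form \<alpha> A)" if "vars A \<subseteq> X" for A T
    unfolding classical_subst using that by (rule classical_cong) (auto simp: img_def)
  have U_img: "classical (img T) U \<longleftrightarrow> classical T U \<and> q \<in> T" for T
  proof -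
    have "classical T (Iff (subst_form \<alpha> U) (ext_U (Var q) U))"
      using eqU by (rule F3.logic_of_classical)
    then have "classical T (subst_form \<alpha> U) \<longleftrightarrow> classical T U \<and> q \<in> T"
      unfolding Iff_def classical.simps classical_ext_U by argo
    then show ?thesis using img[OF X(2), of T] by (rule trans[rotated])
  qed
  have "inj_on img (Pow X)"
  proof (rule inj_onI, rule ccontr)
    fix T T' assume T: "T \<in> Pow X" "T' \<in> Pow X" "img T = img T'" "T \<noteq> T'"
    \<comment> \<open>\<open>T\<close> and \<open>T'\<close> refute \<open>q\<close> and differ on
      \<open>X\<close>; the third leaf satisfies \<open>q\<close>, \<open>U\<close> and
      \<open>Y\<close>.\<close>
    define S where "S l = (case l of Root \<Rightarrow> {} | Leaf1 \<Rightarrow> T | Leaf2 \<Rightarrow> T' | Leaf3 \<Rightarrow> insert q (D \<inter> X))" for l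
    define V where "V x = {l. x \<in> S l}" for x
    have V: "valuation F3 V"
      by (auto simp: valuation_def V_def S_def F3_order)
    have S: "{x. l \<in> V x} = S l" for l by (simp add: V_def)
    have D': "classical (S Leaf3) A \<longleftrightarrow> classical D A" if "vars A \<subseteq> X" for A
      using that by (rule classical_cong) (use X(5) in \<open>auto simp: S_def\<close>)
    have q: "q \<notin> T" "q \<notin> T'" using T X(5) by auto
    have Root_Y: "forces F3 V Root (ext_Y (map Var xs) (Var q) Y)"
      unfolding ext_Y_def forces.simps
    proof (intro conjI ballI impI)
      fix v assume "(Root, v) \<in> snd F3" "forces F3 V v (Neg (Neg (Var q)))"
      then have "v = Leaf3"
        using q F3.forces_NegNeg_leaf[OF V, of v] unfolding S
        by (cases v) (auto simp: S_def F3_order)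
      then show "forces F3 V v Y"
        using D D' X(3) by (simp add: F3.leaf_forces S)
    next
      fix v assume v: "(Root, v) \<in> snd F3" "forces F3 V v (agree (map Var xs) (Var q))"
      \<comment> \<open>A variable separating \<open>T\<close> from \<open>T'\<close> refutes
        agreement at the root; every leaf decides \<open>q\<close>.\<close>
      obtain x where "x \<in> X" "x \<in> T \<longleftrightarrow> x \<notin> T'" using T by blast
      then have "v \<noteq> Root"
        using v(2) q X(4) F3.forces_agree[OF V, of Root] unfolding S
        by (auto simp: S_def F3_order)
      then show "forces F3 V v (decided (Var q))"
        by (cases v) (auto simp: F3.leaf_forces)
    qed
    define W where "W = pull_val F3 V \<alpha>"
    have W: "valuation F3 W" unfolding W_def by (rule F3.valuation_pull_val[OF V])
    have YW: "forces F3 W Root Y"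
      using eqY V Root_Y F3.order_refl unfolding W_def
      by (auto simp: logic_of_def forces_Iff forces_subst[symmetric])
    have W_leaf: "classical {x. l \<in> W x} A \<longleftrightarrow> classical (img (S l)) A"
      if "l \<in> {Leaf1, Leaf2, Leaf3}" "vars A \<subseteq> X" for l A
      using that(2) by (rule classical_cong)
        (use that(1) in \<open>auto simp: W_def pull_val_def img_def F3.leaf_forces S\<close>)
    \<comment> \<open>\<open>Gc\<close> represents both \<open>Leaf1\<close> and
      \<open>Leaf2\<close>, whose images coincide; \<open>Ga\<close> gets \<open>E\<close> to refute
      \<open>Y\<close>, and an empty \<open>Gr\<close> keeps the valuation upward closed.\<close>
    define W' where "W' x = {g. case g of Gr \<Rightarrow> False | Ga \<Rightarrow> x \<in> E | Gb \<Rightarrow> Root \<in> W x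
      | Gc \<Rightarrow> Leaf1 \<in> W x | Gd \<Rightarrow> Leaf3 \<in> W x}" for x
    have W': "valuation G2 W'"
      using W by (auto simp: valuation_def W'_def F3_order G2_order split: g2.splits)
    define h where "h l = (case l of Root \<Rightarrow> Gb | Leaf1 \<Rightarrow> Gc | Leaf2 \<Rightarrow> Gc | Leaf3 \<Rightarrow> Gd)" for l
    have "x \<in> X \<Longrightarrow> Leaf2 \<in> W x \<longleftrightarrow> Leaf1 \<in> W x" for x
      using W_leaf[of _ "Var x"] T(3) by (simp add: S_def)
    then have "forces F3 W Root Y \<longleftrightarrow> forces G2 W' (h Root) Y"
      using X(3)
      by (intro forces_p_morphism)
        (auto simp: h_def W'_def F3_order G2_order split: f3.splits)
    then have "forces G2 W' Gb Y" using YW by (simp add: h_def)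
    moreover have "classical {x. Gd \<in> W' x} U" "\<not> classical {x. Gc \<in> W' x} U"
      using W_leaf X(2) U_img D D' q by (auto simp: W'_def S_def)
    moreover have "\<not> classical {x. Ga \<in> W' x} Y"
      using E by (simp add: W'_def)
    moreover have "forces G2 W' Gr (fork_form U Y)"
      using unif W' by (auto simp: logic_of_def)
    moreover have "(Gr, Gb) \<in> snd G2" "(Gr, Ga) \<in> snd G2" "(Gb, Gc) \<in> snd G2" "(Gb, Gd) \<in> snd G2"
      "Gr \<in> fst G2" "Gb \<in> fst G2"
      by (simp_all add: G2_order)
    ultimately show False
      using G2.forces_fork_form[OF W', of Gr U Y] by blast
  qed
  \<comment> \<open>An injective self-map of a finite set is onto, but \<open>D \<inter> X\<close>
    satisfies \<open>U\<close>, while no \<open>img T\<close> with \<open>q \<notin> T\<close>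
    does.\<close>
  moreover have "img ` Pow X \<subseteq> Pow X" by (auto simp: img_def)
  ultimately have "img ` Pow X = Pow X"
    using X(1) by (simp add: endo_inj_surj)
  then obtain T where "T \<subseteq> X" "img T = D \<inter> X" by (metis Int_lower2 PowD PowI imageE)
  moreover have "classical (D \<inter> X) U"
    using D(1) classical_cong[OF X(2), of "D \<inter> X" D] by simp
  ultimately show False using U_img[of T] X(5) by auto
qed

section \<open>Removing a member from any complete set\<close>

text \<open>Both logics are closed under substitution, so the first equation may be instantiated by
  \<open>\<beta>\<close> and chained with the second.\<close>

lemma subst_eq_trans:
  fixes F :: "'v frame" and G :: "'w frame"
  assumes "three_leaves F M" "three_leaves G N"
    and "subst_eq (logic_of F \<inter> logic_of G) X (subst_comp \<alpha> \<epsilon>) \<mu>"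
    and "subst_eq (logic_of F \<inter> logic_of G) X (subst_comp \<beta> \<mu>) \<nu>"
  shows "subst_eq (logic_of F \<inter> logic_of G) X (subst_comp (subst_comp \<beta> \<alpha>) \<epsilon>) \<nu>"
  unfolding subst_eq_def
proof
  interpret F: three_leaves F M by fact
  interpret G: three_leaves G N by fact
  fix x assume x: "x \<in> X"
  have "subst_form \<beta> (Iff (subst_form \<alpha> (\<epsilon> x)) (\<mu> x)) \<in> logic_of F \<inter> logic_of G"
    using assms(3) x F.logic_of_subst G.logic_of_subst by (auto simp: subst_eq_def subst_comp_def)
  then have "Iff (subst_form (subst_comp \<beta> \<alpha>) (\<epsilon> x)) (subst_form \<beta> (\<mu> x)) \<in> logic_of F \<inter> logic_of G"
    by (simp add: Iff_def subst_form_comp)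
  then show "Iff (subst_comp (subst_comp \<beta> \<alpha>) \<epsilon> x) (\<nu> x) \<in> logic_of F \<inter> logic_of G"
    using assms(4) x F.logic_of_Iff_trans G.logic_of_Iff_trans
    by (auto simp: subst_eq_def subst_comp_def)
qed

theorem theorem5p9:
  shows "nullary_unification (logic_of G2 \<inter> logic_of F3)"
proof -
  let ?L = "logic_of G2 \<inter> logic_of F3"
  define A where "A = fork_form (Var 0) (Var 1)"
  \<comment> \<open>Classically \<open>\<sigma>\<close> is the identity, so the values of any
    unifier more general than it take all combinations of truth values.\<close>
  define \<sigma> where "\<sigma> = Var(1 := And (Var 1) (decided (Var 0)))"
  have vars: "vars A = {0, 1}" by (auto simp: A_def fork_form_def decided_def Neg_def)
  have unifier: "unifier ?L A \<tau> \<longleftrightarrow> fork_form (\<tau> 0) (\<tau> 1) \<in> ?L" for \<tau>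
    by (simp add: unifier_def A_def)
  have \<sigma>: "unifier ?L A \<sigma>"
    using G2.fork_form_unifiable F3.fork_form_unifiable by (simp add: unifier \<sigma>_def)
  note trans = subst_eq_trans[OF G2.three_leaves_axioms F3.three_leaves_axioms]
  have "\<not> minimal_complete_unifiers ?L A S" for S
  proof
    assume "minimal_complete_unifiers ?L A S"
    then have unifiers: "\<And>\<epsilon>. \<epsilon> \<in> S \<Longrightarrow> unifier ?L A \<epsilon>"
      and complete: "\<And>\<mu>. unifier ?L A \<mu> \<Longrightarrow> \<exists>\<epsilon>\<in>S. \<exists>\<alpha>. subst_eq ?L (vars A) (subst_comp \<alpha> \<epsilon>) \<mu>"
      and minimal: "\<And>T. T \<subset> S \<Longrightarrow> \<not> complete_unifiers ?L A T"
      by (auto simp: minimal_complete_unifiers_def complete_unifiers_def)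
    obtain \<epsilon> \<alpha> where \<epsilon>: "\<epsilon> \<in> S" "subst_eq ?L (vars A) (subst_comp \<alpha> \<epsilon>) \<sigma>"
      using complete \<sigma> by blast
    define U where "U = \<epsilon> 0"
    define Y where "Y = \<epsilon> 1"
    define X where "X = vars U \<union> vars Y"
    have "finite X" by (simp add: X_def finite_vars)
    then obtain q xs where q: "q \<notin> X" and xs: "set xs = X"
      by (metis ex_new_if_finite finite_list infinite_UNIV_nat)
    have UY: "fork_form U Y \<in> logic_of G2" "fork_form U Y \<in> logic_of F3"
      using unifiers[OF \<epsilon>(1)] by (simp_all add: unifier U_def Y_def)
    have "Iff (subst_form \<alpha> U) (Var 0) \<in> logic_of F3"
      "Iff (subst_form \<alpha> Y) (And (Var 1) (decided (Var 0))) \<in> logic_of F3"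
      using \<epsilon>(2) by (simp_all add: subst_eq_def vars subst_comp_def U_def Y_def \<sigma>_def)
    from this[THEN F3.logic_of_classical]
    have "classical T (subst_form \<alpha> U) \<longleftrightarrow> 0 \<in> T" "classical T (subst_form \<alpha> Y) \<longleftrightarrow> 1 \<in> T" for T
      by (auto simp: Iff_def)
    \<comment> \<open>Pulling \<open>UNIV\<close> and \<open>{}\<close> back along
      \<open>\<alpha>\<close> gives \<open>D\<close> and \<open>E\<close>.\<close>
    then obtain D E where D: "classical D U" "classical D Y" and E: "\<not> classical E Y"
      unfolding classical_subst by (metis UNIV_I empty_iff)
    \<comment> \<open>\<open>xs\<close> lists all of \<open>X\<close>, so agreement detects any
      difference between assignments to the old variables.\<close>
    define \<epsilon>' where "\<epsilon>' = (\<lambda>x :: nat. if x = 0 then ext_U (Var q) U else ext_Y (map Var xs) (Var q) Y)"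
    have "unifier ?L A \<epsilon>'"
      using UY G2.fork_form_ext F3.fork_form_ext by (simp add: unifier \<epsilon>'_def)
    then obtain \<epsilon>'' \<beta> where \<epsilon>'': "\<epsilon>'' \<in> S" "subst_eq ?L (vars A) (subst_comp \<beta> \<epsilon>'') \<epsilon>'"
      using complete by blast
    have "\<epsilon>'' \<noteq> \<epsilon>"
    proof
      assume "\<epsilon>'' = \<epsilon>"
      then have "Iff (subst_form \<beta> U) (ext_U (Var q) U) \<in> logic_of F3"
        "Iff (subst_form \<beta> Y) (ext_Y (map Var xs) (Var q) Y) \<in> logic_of F3"
        using \<epsilon>''(2) by (simp_all add: subst_eq_def vars subst_comp_def \<epsilon>'_def U_def Y_def)
      then show False
        using ext_not_less_general[OF UY(1) \<open>finite X\<close> _ _ xs q D E] by (simp add: X_def)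
    qed
    let ?\<tau> = "Var(q := Top)"
    have \<tau>: "subst_form ?\<tau> B = B" if "vars B \<subseteq> X" for B
    proof -
      have "subst_form ?\<tau> B = subst_form Var B"
        using that q by (intro subst_form_cong) auto
      then show ?thesis by (simp add: subst_form_Var)
    qed
    have "subst_form ?\<tau> (ext_Y (map Var xs) (Var q) Y) = ext_Y (map Var xs) Top Y"
    proof -
      have "subst_form ?\<tau> (agree (map Var ys) (Var q)) = agree (map Var ys) Top" if "set ys \<subseteq> X" for ys
        using that q by (induction ys) (auto simp: agree_def Conj_def Top_def)
      then show ?thesis using \<tau>[of Y] xs by (simp add: ext_Y_def decided_def X_def)
    qed
    moreover have "subst_form ?\<tau> (ext_U (Var q) U) = ext_U Top U"
      using \<tau>[of U] by (simp add: ext_U_def X_def)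
    ultimately have "subst_eq ?L (vars A) (subst_comp ?\<tau> \<epsilon>') \<epsilon>"
      using G2.ext_U_Top F3.ext_U_Top G2.ext_Y_Top F3.ext_Y_Top
      by (simp add: subst_eq_def vars subst_comp_def \<epsilon>'_def U_def Y_def)
    then have below: "subst_eq ?L (vars A) (subst_comp (subst_comp ?\<tau> \<beta>) \<epsilon>'') \<epsilon>"
      using trans \<epsilon>''(2) by blast
    \<comment> \<open>Every instance of \<open>\<epsilon>\<close> is also an instance of
      \<open>\<epsilon>''\<close>, which stays in the set.\<close>
    have "complete_unifiers ?L A (S - {\<epsilon>})"
      unfolding complete_unifiers_def
    proof (intro conjI allI impI ballI)
      fix \<mu> assume "unifier ?L A \<mu>"
      then obtain \<delta> \<gamma> where \<delta>: "\<delta> \<in> S" "subst_eq ?L (vars A) (subst_comp \<gamma> \<delta>) \<mu>"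
        using complete by blast
      show "\<exists>\<delta>\<in>S - {\<epsilon>}. \<exists>\<gamma>. subst_eq ?L (vars A) (subst_comp \<gamma> \<delta>) \<mu>"
      proof (cases "\<delta> = \<epsilon>")
        case True
        then show ?thesis using trans[OF below] \<delta>(2) \<epsilon>''(1) \<open>\<epsilon>'' \<noteq> \<epsilon>\<close> by blast
      next
        case False
        then show ?thesis using \<delta> by blast
      qed
    qed (use unifiers in blast)
    then show False using minimal[of "S - {\<epsilon>}"] \<epsilon>(1) by blast
  qed
  moreover have "unifiable ?L A" using \<sigma> by (auto simp: unifiable_def)
  ultimately show ?thesis unfolding nullary_unification_def by blast
qed

end
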